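(* Let $k$ be a positive integer. Then for all sufficiently large $n$ the following holds: for every integer $N$ with $0\le N\le n^{k-1}$, any $N$ $k$-rooks placed at distinct points of $H_{n,k}$ cover at most \[ kNn-\frac{(k-1)N^2}{n^{k-2}} \] points of $H_{n,k}$.
   Context: Let $H_{n,k}=\{0,1,\dots,n-1\}^k$. A $k$-rook in $H_{n,k}$ is a point $P\in H_{n,k}$ which covers $P$ itself and every point of $H_{n,k}$ differing from $P$ in exactly one coordinate (i.e., all points at Hamming distance at most $1$ from $P$). *)

theory Defs
  imports Complex_Main "HOL-Library.FuncSet"
begin

text \<open>Points are extensional functions, so two points with the same \<open>k\<close> coordinates are equal.\<close>

definition grid :: "nat \<Rightarrow> nat \<Rightarrow> (nat \<Rightarrow> nat) set" where
  "grid n k = {..<k} \<rightarrow>\<^sub>E {..<n}"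

definition rook_covers :: "nat \<Rightarrow> nat \<Rightarrow> (nat \<Rightarrow> nat) \<Rightarrow> (nat \<Rightarrow> nat) set" where
  "rook_covers n k P = {Q \<in> grid n k. Q = P \<or> card {i \<in> {..<k}. Q i \<noteq> P i} = 1}"

definition covered :: "nat \<Rightarrow> nat \<Rightarrow> (nat \<Rightarrow> nat) set \<Rightarrow> (nat \<Rightarrow> nat) set" where
  "covered n k R = (\<Union>P\<in>R. rook_covers n k P)"

end

theory Submission imports Defs begin

text \<open>
  Let \<open>u\<^sub>i\<close> be the indicator of the points whose line in direction \<open>i\<close> contains a rook. If \<open>m\<close> of
  the \<open>u\<^sub>i\<close> equal 1 at a point, with \<open>1 \<le> m \<le> k\<close>, then \<open>1 \<le> m - m (m - 1) / k\<close>, so the number of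
  covered points is at most the sum of \<open>(u\<^sub>i + u\<^sub>j) / (2 (k - 1)) - u\<^sub>i u\<^sub>j / k\<close> over all points and
  all ordered pairs \<open>i \<noteq> j\<close>. On a plane parallel to the axes \<open>i\<close> and \<open>j\<close> that contains \<open>s\<close> rooks,
  \<open>u\<^sub>i\<close> and \<open>u\<^sub>j\<close> depend on one coordinate each and the inner sum is
  \<open>n (a + b) / (2 (k - 1)) - a b / k\<close> with \<open>a, b \<le> min s n\<close>. For the average number
  \<open>t = N / n\<^bsup>k-2\<^esup>\<close> of rooks per plane this lies below the tangent at \<open>t\<close> of the concave function
  \<open>s \<mapsto> n s / (k - 1) - s\<^sup>2 / k\<close>, provided that \<open>(k - 1) t \<le> n\<close>; summing over planes and pairs
  gives the bound. If \<open>(k - 1) t \<ge> n\<close>, the bound is at least the number \<open>n\<^bsup>k\<^esup>\<close> of all points.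
\<close>

section \<open>Line indicators, weights and basic facts on the grid\<close>

definition line_hit :: "(nat \<Rightarrow> nat) set \<Rightarrow> nat \<Rightarrow> (nat \<Rightarrow> nat) \<Rightarrow> real" where
  "line_hit R i p = of_bool (\<exists>x. p(i := x) \<in> R)"

text \<open>For \<open>k \<ge> 2\<close> the coefficients make the sum over ordered pairs
  \<open>m - m (m - 1) / k\<close>, where \<open>m\<close> counts the directions that are hit. This
  equals 1 exactly at \<open>m = 1\<close> and \<open>m = k\<close>.\<close>

definition pair_weight :: "nat \<Rightarrow> (nat \<Rightarrow> nat) set \<Rightarrow> nat \<Rightarrow> nat \<Rightarrow> (nat \<Rightarrow> nat) \<Rightarrow> real" where
  "pair_weight k R i j p = (line_hit R i p + line_hit R j p) / (2 * (real k - 1))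
     - line_hit R i p * line_hit R j p / real k"

text \<open>A plane parallel to the axes \<open>i\<close> and \<open>j\<close> is named by its point
  with both coordinates 0.\<close>

definition plane_base :: "nat \<Rightarrow> nat \<Rightarrow> (nat \<Rightarrow> nat) \<Rightarrow> nat \<Rightarrow> nat" where
  "plane_base i j p = p(i := 0, j := 0)"

lemma finite_grid: "finite (grid n k)"
  unfolding grid_def by (intro finite_PiE) auto

lemma card_grid: "card (grid n k) = n ^ k"
  unfolding grid_def by (simp add: card_PiE)

lemma grid_update: "p \<in> grid n k \<Longrightarrow> i < k \<Longrightarrow> x < n \<Longrightarrow> p(i := x) \<in> grid n k"
  unfolding grid_def by (auto simp: PiE_iff extensional_def)

lemma grid_less: "p \<in> grid n k \<Longrightarrow> i < k \<Longrightarrow> p i < n"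
  unfolding grid_def by (auto simp: PiE_iff)

section \<open>Pointwise bound on the covered indicator\<close>

lemma covered_imp_line:
  assumes "R \<subseteq> grid n k" "k > 0" "Q \<in> covered n k R"
  obtains i where "i < k" "line_hit R i Q = 1"
proof -
  obtain P where P: "P \<in> R" "Q \<in> grid n k" "Q = P \<or> card {i \<in> {..<k}. Q i \<noteq> P i} = 1"
    using assms(3) unfolding covered_def rook_covers_def by auto
  show ?thesis
  proof (cases "Q = P")
    case True
    then have "Q(0 := Q 0) \<in> R" using P by simp
    then have "line_hit R 0 Q = 1" unfolding line_hit_def of_bool_eq_1_iff by (rule exI)
    then show ?thesis using that assms by blast
  next
    case False
    then obtain i where i: "{i \<in> {..<k}. Q i \<noteq> P i} = {i}"
      using P(3) by (auto simp: card_1_singleton_iff)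
    have "P \<in> grid n k" using assms(1) P(1) by auto
    have "Q(i := P i) = P"
    proof
      fix x
      show "(Q(i := P i)) x = P x"
      proof (cases "x < k")
        case True
        then show ?thesis using i by (cases "x = i") auto
      next
        case False
        \<comment> \<open>Points of the grid share one default value outside
          \<open>{..<k}\<close>.\<close>
        then have "Q x = undefined" "P x = undefined"
          using P(2) \<open>P \<in> grid n k\<close> unfolding grid_def by auto
        then show ?thesis by auto
      qed
    qed
    then have "Q(i := P i) \<in> R" using P(1) by simp
    then have "line_hit R i Q = 1" unfolding line_hit_def of_bool_eq_1_iff by (rule exI)
    then show ?thesis using that i by blast
  qed
qed

text \<open>Each indicator occurs in \<open>2 (k - 1)\<close> ordered pairs. Indicators are
  idempotent, so the products over \<open>i \<noteq> j\<close> add up to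
  \<open>m^2 - m\<close>.\<close>

lemma sum_pair_weight:
  fixes k :: nat and R :: "(nat \<Rightarrow> nat) set" and p :: "nat \<Rightarrow> nat"
  assumes "k \<ge> 2"
  defines "m \<equiv> \<Sum>i<k. line_hit R i p"
  shows "(\<Sum>i<k. \<Sum>j\<in>{..<k} - {i}. pair_weight k R i j p) = m - (m ^ 2 - m) / k"
proof -
  let ?h = "\<lambda>i. line_hit R i p"
  have idem: "?h i * ?h i = ?h i" for i
    unfolding line_hit_def by (simp only: of_bool_conj[symmetric] simp_thms)
  have "(\<Sum>j\<in>{..<k} - {i}. pair_weight k R i j p)
      = (real k * ?h i + m) / (2 * (real k - 1)) - ?h i * m / k
        - (2 * ?h i / (2 * (real k - 1)) - ?h i / k)" if "i < k" for i
  proof -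
    \<comment> \<open>Completing the sum by the diagonal term \<open>j = i\<close> lets it
      factor.\<close>
    have "(\<Sum>j\<in>{..<k} - {i}. pair_weight k R i j p)
        = (\<Sum>j<k. pair_weight k R i j p) - pair_weight k R i i p"
      using that by (simp add: sum_diff1)
    also have "(\<Sum>j<k. pair_weight k R i j p)
        = (real k * ?h i + m) / (2 * (real k - 1)) - ?h i * m / k"
      unfolding pair_weight_def m_def
      by (simp add: sum_subtractf sum.distrib flip: sum_divide_distrib sum_distrib_left)
    also have "pair_weight k R i i p = 2 * ?h i / (2 * (real k - 1)) - ?h i / k"
      unfolding pair_weight_def by (simp only: idem mult_2)
    finally show ?thesis .
  qed
  then have "(\<Sum>i<k. \<Sum>j\<in>{..<k} - {i}. pair_weight k R i j p)
      = (\<Sum>i<k. (real k * ?h i + m) / (2 * (real k - 1)) - ?h i * m / k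
        - (2 * ?h i / (2 * (real k - 1)) - ?h i / k))" by simp
  also have "\<dots> = (real k * m + real k * m) / (2 * (real k - 1)) - m * m / k
        - (2 * m / (2 * (real k - 1)) - m / k)"
    by (simp only: sum_subtractf sum.distrib m_def sum_constant card_lessThan
        flip: sum_divide_distrib sum_distrib_left sum_distrib_right)
  also have "\<dots> = m - (m ^ 2 - m) / k"
  proof -
    have "(real k * m + real k * m) / (2 * (real k - 1)) = m + m / (real k - 1)"
      using assms(1) by (simp add: field_simps)
    moreover have "2 * m / (2 * (real k - 1)) = m / (real k - 1)"
      by (rule mult_divide_mult_cancel_left) simp
    ultimately show ?thesis by (simp only: diff_divide_distrib power2_eq_square)
  qed
  finally show ?thesis .
qed

lemma covered_le_sum_pair_weight:
  assumes "R \<subseteq> grid n k" "k \<ge> 2" "p \<in> grid n k"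
  shows "of_bool (p \<in> covered n k R) \<le> (\<Sum>i<k. \<Sum>j\<in>{..<k} - {i}. pair_weight k R i j p)"
proof -
  define m where "m = (\<Sum>i<k. line_hit R i p)"
  have hit: "0 \<le> line_hit R i p" "line_hit R i p \<le> 1" for i
    unfolding line_hit_def by auto
  have "m \<le> (\<Sum>i<k. 1)" unfolding m_def by (intro sum_mono hit)
  then have mk: "m \<le> k" by simp
  have m0: "0 \<le> m" unfolding m_def by (intro sum_nonneg hit)
  have "of_bool (p \<in> covered n k R) \<le> m - (m ^ 2 - m) / k"
  proof (cases "p \<in> covered n k R")
    case True
    obtain i where i: "i < k" "line_hit R i p = 1"
      using covered_imp_line[OF assms(1) _ True] assms(2) by auto
    have "line_hit R i p \<le> m"
      unfolding m_def using i by (intro member_le_sum hit) auto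
    \<comment> \<open>This product is \<open>k\<close> times the difference of the two sides, whose
      left side is 1 here.\<close>
    then have "(m - 1) * (k - m) \<ge> 0" using mk i by simp
    then show ?thesis using True assms(2) by (simp add: field_simps power2_eq_square)
  next
    case False
    have "m * (real k + 1 - m) \<ge> 0" using mk m0 by simp
    then show ?thesis using False assms(2) by (simp add: field_simps power2_eq_square)
  qed
  then show ?thesis using sum_pair_weight[OF assms(2), of R p] unfolding m_def by simp
qed

section \<open>Planes parallel to two axes\<close>

text \<open>Serves to count the points of a plane and to turn a sum over it into a double sum over
  the two free coordinates.\<close>

lemma plane_fibre:
  assumes "i \<noteq> j" "i < k" "j < k" "c \<in> plane_base i j ` grid n k"
  shows "bij_betw (\<lambda>(x, y). c(i := x, j := y)) ({..<n} \<times> {..<n})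
    {p \<in> grid n k. plane_base i j p = c}"
proof (rule bij_betw_byWitness[where f' = "\<lambda>p. (p i, p j)"])
  obtain p0 where p0: "p0 \<in> grid n k" "c = p0(i := 0, j := 0)"
    using assms(4) unfolding plane_base_def by auto
  show "\<forall>a\<in>{..<n} \<times> {..<n}. (\<lambda>p. (p i, p j)) ((\<lambda>(x, y). c(i := x, j := y)) a) = a"
    using assms(1) by auto
  show "\<forall>p\<in>{p \<in> grid n k. plane_base i j p = c}. (\<lambda>(x, y). c(i := x, j := y)) (p i, p j) = p"
    unfolding plane_base_def by (auto simp: fun_eq_iff)
  have upd: "c(i := x, j := y) = p0(i := x, j := y)" for x y
    using p0(2) assms(1) by (auto simp: fun_eq_iff)
  show "(\<lambda>(x, y). c(i := x, j := y)) ` ({..<n} \<times> {..<n}) \<subseteq> {p \<in> grid n k. plane_base i j p = c}"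
    unfolding upd using p0 assms
    by (auto simp: plane_base_def fun_eq_iff intro!: grid_update)
  show "(\<lambda>p. (p i, p j)) ` {p \<in> grid n k. plane_base i j p = c} \<subseteq> {..<n} \<times> {..<n}"
    using assms by (auto intro: grid_less)
qed

text \<open>The \<open>n^k\<close> points of the grid split into planes of \<open>n^2\<close> points
  each.\<close>

lemma card_planes:
  assumes "i \<noteq> j" "i < k" "j < k" "n > 0"
  shows "card (plane_base i j ` grid n k) = n ^ (k - 2)"
proof -
  let ?B = "plane_base i j ` grid n k"
  have "n ^ k = (\<Sum>p\<in>grid n k. 1)" by (simp add: card_grid)
  also have "\<dots> = (\<Sum>c\<in>?B. \<Sum>p\<in>{p \<in> grid n k. plane_base i j p = c}. 1)"
    by (rule sum.group[symmetric]) (auto simp: finite_grid)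
  also have "\<dots> = (\<Sum>c\<in>?B. n ^ 2)"
    using bij_betw_same_card[OF plane_fibre[OF assms(1-3)]]
    by (intro sum.cong) (auto simp: power2_eq_square)
  also have "\<dots> = card ?B * n ^ 2" by simp
  finally have eq: "n ^ k = card ?B * n ^ 2" .
  have "k \<ge> 2" using assms by linarith
  then obtain l where "k = 2 + l" using le_Suc_ex by blast
  then have "n ^ k = n ^ (k - 2) * n ^ 2" by (simp add: power2_eq_square)
  then show ?thesis using eq assms(4) by simp
qed

text \<open>For \<open>2 < K < 3\<close> this fails at \<open>a = s = n\<close>, \<open>b = 0\<close>, \<open>t = n / (K - 1)\<close>.\<close>

lemma plane_tangent_bound:
  fixes K a b s t n :: real
  assumes K: "K = 2 \<or> K \<ge> 3" and ab: "0 \<le> a" "0 \<le> b" "a \<le> s" "b \<le> s" "a \<le> n" "b \<le> n"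
    and t: "0 \<le> t" "(K - 1) * t \<le> n"
  shows "n * (a + b) / (2 * (K - 1)) - a * b / K \<le> n * s / (K - 1) - (2 * t * s - t ^ 2) / K"
proof -
  \<comment> \<open>The claim multiplied by \<open>2 K (K - 1)\<close>, for
    \<open>b \<le> a\<close>; the other order follows by symmetry. Below, the gap is right side
    minus left side.\<close>
  have bound: "K * n * (a + b) - 2 * (K - 1) * (a * b)
      \<le> 2 * K * n * s - 2 * (K - 1) * (2 * t * s - t ^ 2)"
    if ab: "0 \<le> b" "b \<le> a" "a \<le> s" "a \<le> n" for a b
  proof -
    define w where "w = (K - 1) * t"
    have K2: "K \<ge> 2" using K by auto
    have w: "0 \<le> w" "w \<le> n" using t K2 unfolding w_def by auto
    \<comment> \<open>This is \<open>K - 1\<close> times the gap at \<open>b = 0\<close>,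
      \<open>a = s = n\<close>.\<close>
    have top: "2 * w ^ 2 + K * (K - 1) * n ^ 2 - 4 * (K - 1) * w * n \<ge> 0"
    proof -
      \<comment> \<open>The form is expanded in \<open>w\<close> and \<open>n - w\<close>. Its
        \<open>w^2\<close> coefficient \<open>(K - 2) (K - 3)\<close> is where the hypothesis on
        \<open>K\<close> enters.\<close>
      have "(K - 2) * (K - 3) \<ge> 0" using K by auto
      then have "w ^ 2 * ((K - 2) * (K - 3)) \<ge> 0" by simp
      moreover have "w * (n - w) * ((K - 1) * (2 * K - 4)) \<ge> 0"
        using w K2 by simp
      moreover have "K * (K - 1) * (n - w) ^ 2 \<ge> 0" using K2 by simp
      ultimately show ?thesis by (simp add: algebra_simps power2_eq_square)
    qed
    \<comment> \<open>The gap at \<open>b = 0\<close>, \<open>s = a\<close>. It is affine in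
      \<open>a\<close>, so it is interpolated between \<open>a = 0\<close> and \<open>a = n\<close>,
      the latter being \<open>top\<close>.\<close>
    have zero: "K * n * a - 2 * (K - 1) * (2 * t * a - t ^ 2) \<ge> 0"
    proof (cases "n = 0")
      case True
      then have "t = 0" using t K2 by (simp add: mult_le_0_iff)
      then show ?thesis using True by simp
    next
      case False
      have "(n - a) * (2 * w ^ 2)
          + a * (2 * w ^ 2 + K * (K - 1) * n ^ 2 - 4 * (K - 1) * w * n) \<ge> 0"
        using top ab by simp
      also have "(n - a) * (2 * w ^ 2)
          + a * (2 * w ^ 2 + K * (K - 1) * n ^ 2 - 4 * (K - 1) * w * n)
          = n * (K - 1) * (K * n * a - 2 * (K - 1) * (2 * t * a - t ^ 2))"
        unfolding w_def by (simp add: algebra_simps power2_eq_square)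
      finally show ?thesis
        using False ab K2 mult_pos_pos[of n "K - 1"] by (smt (verit) mult_pos_neg)
    qed
    \<comment> \<open>The gap at \<open>b = a = s\<close>.\<close>
    have diag: "2 * (K - 1) * (a - t) ^ 2 \<ge> 0" using K2 by simp
    have "K * n * (a + b) - 2 * (K - 1) * (a * b)
        \<le> 2 * K * n * a - 2 * (K - 1) * (2 * t * a - t ^ 2)"
    proof (cases "a = 0")
      case True
      then show ?thesis using ab K2 by simp
    next
      case False
      \<comment> \<open>The difference of the two sides is affine in \<open>b\<close>, so the endpoints \<open>b = 0\<close> and \<open>b = a\<close>
        suffice.\<close>
      have "(a - b) * (K * n * a - 2 * (K - 1) * (2 * t * a - t ^ 2))
          + b * (2 * (K - 1) * (a - t) ^ 2) \<ge> 0"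
        using zero diag ab by (intro add_nonneg_nonneg mult_nonneg_nonneg[of "a - b"]
            mult_nonneg_nonneg[of b]) auto
      also have "(a - b) * (K * n * a - 2 * (K - 1) * (2 * t * a - t ^ 2))
          + b * (2 * (K - 1) * (a - t) ^ 2)
          = a * ((2 * K * n * a - 2 * (K - 1) * (2 * t * a - t ^ 2))
            - (K * n * (a + b) - 2 * (K - 1) * (a * b)))"
        by (simp add: algebra_simps power2_eq_square)
      finally show ?thesis using False ab by (simp add: zero_le_mult_iff)
    qed
    \<comment> \<open>The right side is affine in \<open>s\<close> with slope
      \<open>2 (K n - 2 w) \<ge> 0\<close>, so \<open>a\<close> may be replaced by
      \<open>s\<close>.\<close>
    also have "\<dots> \<le> 2 * K * n * s - 2 * (K - 1) * (2 * t * s - t ^ 2)"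
    proof -
      have "2 * w \<le> K * n" using w K2 mult_mono[of 2 K w n] by simp
      then have "(s - a) * (2 * (K * n - 2 * w)) \<ge> 0" using ab by simp
      then show ?thesis unfolding w_def by (simp add: algebra_simps)
    qed
    finally show ?thesis .
  qed
  have "K * n * (a + b) - 2 * (K - 1) * (a * b)
      \<le> 2 * K * n * s - 2 * (K - 1) * (2 * t * s - t ^ 2)"
    using bound[of b a] bound[of a b] ab
    by (cases "b \<le> a") (auto simp: add.commute mult.commute)
  then have le: "(K * n * (a + b) - 2 * (K - 1) * (a * b)) / (2 * K * (K - 1))
      \<le> (2 * K * n * s - 2 * (K - 1) * (2 * t * s - t ^ 2)) / (2 * K * (K - 1))"
    using K by (intro divide_right_mono) auto
  have split: "(K * x - 2 * d * y) / (2 * K * d) = x / (2 * d) - y / K"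
    if "d > 0" for x y d
    using that K by (auto simp: field_simps)
  have "(K * n * (a + b) - 2 * (K - 1) * (a * b)) / (2 * K * (K - 1))
      = n * (a + b) / (2 * (K - 1)) - a * b / K"
    using split[of "K - 1" "n * (a + b)" "a * b"] K by (auto simp: mult.assoc)
  moreover have "(2 * K * n * s - 2 * (K - 1) * (2 * t * s - t ^ 2)) / (2 * K * (K - 1))
      = n * s / (K - 1) - (2 * t * s - t ^ 2) / K"
  proof -
    have "2 * K * n * s = K * (2 * (n * s))" by simp
    moreover have "2 * (n * s) / (2 * (K - 1)) = n * s / (K - 1)"
      by (rule mult_divide_mult_cancel_left) simp
    moreover have "K - 1 > 0" using K by auto
    ultimately show ?thesis using split[of "K - 1" "2 * (n * s)" "2 * t * s - t ^ 2"]
      by (simp only:)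
  qed
  ultimately show ?thesis using le by (simp only:)
qed

lemma sum_plane_pair_weight_le:
  assumes R: "R \<subseteq> grid n k" and k: "k \<ge> 2" and ij: "i \<noteq> j" "i < k" "j < k"
    and c: "c \<in> plane_base i j ` grid n k"
    and t: "0 \<le> t" "(real k - 1) * t \<le> real n"
  defines "s \<equiv> real (card {p \<in> R. plane_base i j p = c})"
  shows "(\<Sum>p\<in>{p \<in> grid n k. plane_base i j p = c}. pair_weight k R i j p)
    \<le> real n * s / (real k - 1) - (2 * t * s - t ^ 2) / real k"
proof -
  let ?S = "{p \<in> R. plane_base i j p = c}"
  have finS: "finite ?S" using R finite_grid[of n k] finite_subset by fastforce
  \<comment> \<open>\<open>A\<close> indexes the hit lines in direction \<open>i\<close>,
    \<open>B\<close> those in direction \<open>j\<close>. Both are projections of the rooks in the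
    plane, so each has size at most \<open>s\<close>.\<close>
  define A where "A = {y. y < n \<and> (\<exists>x. c(i := x, j := y) \<in> R)}"
  define B where "B = {x. x < n \<and> (\<exists>y. c(i := x, j := y) \<in> R)}"
  have base: "plane_base i j (c(i := x, j := y)) = c" for x y
    using c ij unfolding plane_base_def by (auto simp: fun_eq_iff)
  have "A \<subseteq> (\<lambda>p. p j) ` ?S" unfolding A_def using base by (force simp: image_iff)
  then have As: "card A \<le> card ?S" using finS surj_card_le by blast
  have "B \<subseteq> (\<lambda>p. p i) ` ?S"
  proof
    fix x assume "x \<in> B"
    then obtain y where "c(i := x, j := y) \<in> R" unfolding B_def by auto
    then have "c(i := x, j := y) \<in> ?S" using base by simp
    then have "(c(i := x, j := y)) i \<in> (\<lambda>p. p i) ` ?S" by (rule imageI)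
    then show "x \<in> (\<lambda>p. p i) ` ?S" using ij by simp
  qed
  then have Bs: "card B \<le> card ?S" using finS surj_card_le by blast
  have An: "card A \<le> n" using card_mono[of "{..<n}" A] unfolding A_def by auto
  have Bn: "card B \<le> n" using card_mono[of "{..<n}" B] unfolding B_def by auto
  have hi: "line_hit R i (c(i := x, j := y)) = of_bool (y \<in> A)" if "y < n" for x y
  proof -
    have "(c(i := x, j := y))(i := z) = c(i := z, j := y)" for z
      using ij by (auto simp: fun_eq_iff)
    then show ?thesis unfolding line_hit_def A_def using that by simp
  qed
  have hj: "line_hit R j (c(i := x, j := y)) = of_bool (x \<in> B)" if "x < n" for x y
    unfolding line_hit_def B_def using that by simp
  have sumA: "(\<Sum>y<n. of_bool (y \<in> A)) = real (card A)"
  proof -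
    have "{..<n} \<inter> {y. y \<in> A} = A" unfolding A_def by auto
    then show ?thesis by (simp add: sum_of_bool_eq)
  qed
  have sumB: "(\<Sum>x<n. of_bool (x \<in> B)) = real (card B)"
  proof -
    have "{..<n} \<inter> {y. y \<in> B} = B" unfolding B_def by auto
    then show ?thesis by (simp add: sum_of_bool_eq)
  qed
  have "(\<Sum>p\<in>{p \<in> grid n k. plane_base i j p = c}. pair_weight k R i j p)
      = (\<Sum>(x, y)\<in>{..<n} \<times> {..<n}. pair_weight k R i j (c(i := x, j := y)))"
    using sum.reindex_bij_betw[OF plane_fibre[OF ij c], of "pair_weight k R i j"]
    by (simp add: case_prod_unfold)
  also have "\<dots> = (\<Sum>x<n. \<Sum>y<n. pair_weight k R i j (c(i := x, j := y)))"
    by (rule sum.cartesian_product[symmetric])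
  also have "\<dots> = (\<Sum>x<n. \<Sum>y<n. (of_bool (y \<in> A) + of_bool (x \<in> B)) / (2 * (real k - 1))
      - of_bool (y \<in> A) * of_bool (x \<in> B) / real k)"
    by (intro sum.cong refl) (simp add: pair_weight_def hi hj del: fun_upd_apply)
  also have "\<dots> = (\<Sum>x<n. (real (card A) + real n * of_bool (x \<in> B)) / (2 * (real k - 1))
      - real (card A) * of_bool (x \<in> B) / real k)"
    by (simp only: sum_subtractf sum.distrib sum_constant card_lessThan sumA
        flip: sum_divide_distrib sum_distrib_left sum_distrib_right)
  also have "\<dots> = (real n * card A + real n * card B) / (2 * (real k - 1))
      - real (card A) * real (card B) / real k"
    by (simp only: sum_subtractf sum.distrib sum_constant card_lessThan sumB
        of_nat_mult flip: sum_divide_distrib sum_distrib_left sum_distrib_right)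
  also have "\<dots> = real n * (card A + card B) / (2 * (real k - 1)) - real (card A) * real (card B) / real k"
    by (simp add: algebra_simps)
  \<comment> \<open>An integer \<open>k \<ge> 2\<close> is 2 or at least 3, as the tangent bound
    demands.\<close>
  also have "\<dots> \<le> real n * s / (real k - 1) - (2 * t * s - t ^ 2) / real k"
    using plane_tangent_bound[of "real k" "real (card A)" "real (card B)" s "real n" t]
      k As Bs An Bn t unfolding s_def by fastforce
  finally show ?thesis .
qed

section \<open>Summation over planes and directions\<close>

text \<open>The plane bounds share the tangent point \<open>t\<close>, so they are the same affine
  function of \<open>s\<close> and their sum depends only on the number of rooks. As
  \<open>t\<close> is the average of \<open>s\<close>, the tangent loses nothing there.\<close>

lemma sum_pair_weight_le:
  assumes R: "R \<subseteq> grid n k" and k: "k \<ge> 2" and n: "n > 0" and ij: "i \<noteq> j" "i < k" "j < k"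
    and N: "(real k - 1) * card R \<le> real n ^ (k - 1)"
  shows "(\<Sum>p\<in>grid n k. pair_weight k R i j p)
    \<le> real n * card R / (real k - 1) - (real (card R))\<^sup>2 / (real n ^ (k - 2) * real k)"
proof -
  let ?B = "plane_base i j ` grid n k"
  define M where "M = real n ^ (k - 2)"
  define t where "t = card R / M"
  let ?s = "\<lambda>c. real (card {p \<in> R. plane_base i j p = c})"
  have M: "M > 0" using n unfolding M_def by simp
  have "real n ^ (k - 1) = real n * M"
    unfolding M_def using le_Suc_ex[OF k] by auto
  then have t: "0 \<le> t" "(real k - 1) * t \<le> real n"
    using N M unfolding t_def by (simp_all add: field_simps)
  have finR: "finite R" using R finite_grid finite_subset by blast
  have cardB: "real (card ?B) = M" using card_planes[OF ij n] unfolding M_def by simp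
  have "real (card R) = (\<Sum>c\<in>?B. \<Sum>p\<in>{p \<in> R. plane_base i j p = c}. 1)"
    using R finR by (subst sum.group) (auto simp: finite_grid)
  then have sums: "(\<Sum>c\<in>?B. ?s c) = card R" by simp
  have "(\<Sum>p\<in>grid n k. pair_weight k R i j p)
      = (\<Sum>c\<in>?B. \<Sum>p\<in>{p \<in> grid n k. plane_base i j p = c}. pair_weight k R i j p)"
    by (rule sum.group[symmetric]) (auto simp: finite_grid)
  also have "\<dots> \<le> (\<Sum>c\<in>?B. real n * ?s c / (real k - 1) - (2 * t * ?s c - t ^ 2) / real k)"
    by (intro sum_mono sum_plane_pair_weight_le[OF R k ij _ t])
  also have "\<dots> = real n * card R / (real k - 1) - (2 * t * card R - M * t ^ 2) / real k"
    by (simp only: sum_subtractf sum_constant sums cardB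
        flip: sum_divide_distrib sum_distrib_left)
  also have "2 * t * card R - M * t ^ 2 = (card R)\<^sup>2 / M"
    unfolding t_def using M by (simp add: field_simps power2_eq_square)
  finally show ?thesis unfolding M_def by simp
qed

lemma card_covered_le:
  assumes R: "R \<subseteq> grid n k" and k: "k \<ge> 2" and n: "n > 0" and N: "card R \<le> n ^ (k - 1)"
  shows "real (card (covered n k R))
    \<le> real k * card R * real n - (real k - 1) * (card R)\<^sup>2 / real n ^ (k - 2)"
proof -
  define M where "M = real n ^ (k - 2)"
  have M: "M > 0" using n unfolding M_def by simp
  have nM: "real n ^ (k - 1) = real n * M"
    unfolding M_def using le_Suc_ex[OF k] by auto
  have cov: "covered n k R \<subseteq> grid n k"
    unfolding covered_def rook_covers_def by auto
  show ?thesis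
  proof (cases "(real k - 1) * card R \<le> real n ^ (k - 1)")
    case True
    have "real (card (covered n k R)) = (\<Sum>p\<in>grid n k. of_bool (p \<in> covered n k R))"
      using cov finite_grid by (simp add: sum_of_bool_eq Int_absorb1)
    also have "\<dots> \<le> (\<Sum>p\<in>grid n k. \<Sum>i<k. \<Sum>j\<in>{..<k} - {i}. pair_weight k R i j p)"
      by (intro sum_mono covered_le_sum_pair_weight R k)
    also have "\<dots> = (\<Sum>i<k. \<Sum>p\<in>grid n k. \<Sum>j\<in>{..<k} - {i}. pair_weight k R i j p)"
      by (rule sum.swap)
    also have "\<dots> = (\<Sum>i<k. \<Sum>j\<in>{..<k} - {i}. \<Sum>p\<in>grid n k. pair_weight k R i j p)"
      by (intro sum.cong refl sum.swap)
    also have "\<dots> \<le> (\<Sum>i<k. \<Sum>j\<in>{..<k} - {i}.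
        real n * card R / (real k - 1) - (real (card R))\<^sup>2 / (M * real k))"
      unfolding M_def using True by (intro sum_mono sum_pair_weight_le R k n) auto
    also have "\<dots> = real k * (real k - 1)
        * (real n * card R / (real k - 1) - (real (card R))\<^sup>2 / (M * real k))"
      using k by (simp add: card_Diff_singleton of_nat_diff)
    also have "\<dots> = real k * card R * real n - (real k - 1) * (card R)\<^sup>2 / M"
      using k M by (simp add: field_simps)
    finally show ?thesis unfolding M_def .
  next
    case False
    define t where "t = card R / M"
    have R_eq: "real (card R) = t * M" unfolding t_def using M by simp
    have "real (card R) \<le> real n * M" using N nM by (metis of_nat_le_iff of_nat_power)
    then have t1: "t \<le> n" using M unfolding R_eq by simp
    have "real n * M \<le> (real k - 1) * t * M" using False nM R_eq by simp
    then have t2: "n \<le> (real k - 1) * t" using M by simp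
    have "real (card (covered n k R)) \<le> real n ^ k"
      using card_mono[OF finite_grid cov] card_grid by (metis of_nat_le_iff of_nat_power)
    also have "\<dots> = real n ^ 2 * M"
      unfolding M_def using le_Suc_ex[OF k] by (auto simp: power2_eq_square)
    also have "\<dots> \<le> (real k * t * n - (real k - 1) * t ^ 2) * M"
    proof -
      \<comment> \<open>After division by \<open>M\<close>, the bound minus the number of grid
        points factors into this product.\<close>
      have "(n - t) * ((real k - 1) * t - n) \<ge> 0" using t1 t2 by simp
      then show ?thesis
        using M by (intro mult_right_mono) (simp_all add: algebra_simps power2_eq_square)
    qed
    also have "\<dots> = real k * card R * real n - (real k - 1) * (card R)\<^sup>2 / M"
      unfolding R_eq of_nat_power using M by (simp add: field_simps power2_eq_square)
    finally show ?thesis unfolding M_def .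
  qed
qed

theorem theorem7:
  fixes k :: nat
  assumes "k > 0"
  shows "\<forall>\<^sub>F n :: nat in sequentially. \<forall>N :: nat. N \<le> n ^ (k - 1) \<longrightarrow>
    (\<forall>R. R \<subseteq> grid n k \<and> card R = N \<longrightarrow>
      real (card (covered n k R))
        \<le> real k * real N * real n
            - (real k - 1) * real N ^ 2 / real n powi (int k - 2))"
proof (rule eventually_sequentiallyI[of 1], intro allI impI)
  \<comment> \<open>The threshold is \<open>n \<ge> 1\<close>. The case \<open>k = 1\<close> is
    separate because it has no pair of directions.\<close>
  fix n N :: nat and R
  assume n: "1 \<le> n" and N: "N \<le> n ^ (k - 1)" and R: "R \<subseteq> grid n k \<and> card R = N"
  show "real (card (covered n k R)) \<le> real k * real N * real n
      - (real k - 1) * real N ^ 2 / real n powi (int k - 2)"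
  proof (cases "k = 1")
    case True
    \<comment> \<open>For \<open>k = 1\<close> the quadratic term vanishes and the grid is a single
      line of \<open>n\<close> points.\<close>
    have "card (covered n k R) \<le> N * n"
    proof (cases "R = {}")
      case True
      then show ?thesis by (simp add: covered_def)
    next
      case False
      have "finite R" using R finite_grid finite_subset by blast
      then have "N \<ge> 1" using False R 
        by (metis One_nat_def Suc_leI card_gt_0_iff)
      have "covered n k R \<subseteq> grid n k" unfolding covered_def rook_covers_def by auto
      then have "card (covered n k R) \<le> n"
        using card_mono[OF finite_grid] card_grid[of n k] \<open>k = 1\<close> by (metis power_one_right)
      also have "\<dots> \<le> N * n" using \<open>N \<ge> 1\<close> by simp
      finally show ?thesis .
    qed
    then have "real (card (covered n k R)) \<le> real N * real n"
      by (metis of_nat_le_iff of_nat_mult)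
    then show ?thesis using True by simp
  next
    case False
    then have k: "k \<ge> 2" using assms by simp
    then have "real n powi (int k - 2) = real n ^ (k - 2)"
      by (simp add: power_int_def nat_diff_distrib)
    then show ?thesis using card_covered_le[of R n k] k n N R by simp
  qed
qed

end
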